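(* Let $(X_t)_{t\ge 0}$ and, for each $\delta>0$, $(X_t^{\delta})_{t\ge 0}$ be time-homogeneous Markov processes on a state space $\mathbb{X}$ with transition functions $(p_t)_{t\ge 0}$ and $(p_t^{\delta})_{t\ge 0}$, and let $\mathbf{dist}$ be a distance on the set $\mathcal{P}(\mathbb{X})$ of probability measures on $\mathbb{X}$. Assume: (1) (Contractivity) There exists $\lambda>0$ such that for all $\nu,\eta\in\mathcal{P}(\mathbb{X})$ and all $t>0$, $\mathbf{dist}(\nu p_t,\eta p_t)\le e^{-\lambda t}\,\mathbf{dist}(\nu,\eta)$. (2) (Finite time convergence) There exist a time $\tau>0$, a constant $\alpha>0$ and a function $\mathbf{M}:\mathcal{P}(\mathbb{X})\to[0,\infty)$, not depending on $\delta$, such that for all $\nu\in\mathcal{P}(\mathbb{X})$ and all $\delta>0$, $\sup_{t\le\tau}\mathbf{dist}(\nu p_t,\nu p_t^{\delta})\le\delta^{\alpha}\mathbf{M}(\nu)$. (3) (Uniform control) For every $\nu\in\mathcal{P}(\mathbb{X})$ there exists a constant $\mathbf{C}(\nu)<\infty$, independent of $t$ and $\delta$, such that $\sup_{t\ge0}\mathbf{M}(\nu p_t^{\delta})\le\mathbf{C}(\nu)$ for all $\delta>0$. Let $\nu\in\mathcal{P}(\mathbb{X})$. Then there exists a constant $\tilde{\mathbf{C}}>0$, independent of $\delta$ and $t$, such that for all $t\ge0$ (and all $\delta>0$) $$\mathbf{dist}(\nu p_t,\nu p_t^{\delta})\le\tilde{\mathbf{C}}\,\delta^{\alpha}.$$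
   Context: For a probability measure $\nu$ on $\mathbb{X}$, $\nu p_t(\mathrm{d}z)=\int_{\mathbb{X}}\nu(\mathrm{d}x)\,p_t(x,\mathrm{d}z)$ is the law at time $t$ of the process started from $\nu$; similarly $\nu p_t^{\delta}$. Time homogeneity means that the transition functions do not depend on the starting time and satisfy the semigroup property: $p_0$ is the identity and $\nu p_s p_t=\nu p_{s+t}$, and likewise for $p^{\delta}$. *)

theory Defs
  imports "HOL-Probability.Probability" "HOL-Analysis.Abstract_Metric_Spaces"
begin

abbreviation prob_measures :: "'x measure \<Rightarrow> 'x measure set"
  where "prob_measures S \<equiv> space (prob_algebra S)"

(* The time argument is a real; every condition is imposed at nonnegative times only.
   For nu in prob_measures S, the monadic bind is the action of a kernel on a measure:
   (nu \<bind> p t) A = \<integral>x. p t x A dnu. *)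
definition markov_transition_function :: "'x measure \<Rightarrow> (real \<Rightarrow> 'x \<Rightarrow> 'x measure) \<Rightarrow> bool"
  where "markov_transition_function S p \<longleftrightarrow>
    (\<forall>t\<ge>0. p t \<in> S \<rightarrow>\<^sub>M prob_algebra S) \<and>
    (\<forall>\<nu>\<in>prob_measures S. \<nu> \<bind> p 0 = \<nu>) \<and>
    (\<forall>\<nu>\<in>prob_measures S. \<forall>s\<ge>0. \<forall>t\<ge>0. (\<nu> \<bind> p s) \<bind> p t = \<nu> \<bind> p (s + t))"

(* Only the space and the sigma-algebra of this measure are meaningful. *)
definition natural_filtration ::
    "'w measure \<Rightarrow> 'x measure \<Rightarrow> (real \<Rightarrow> 'w \<Rightarrow> 'x) \<Rightarrow> real \<Rightarrow> 'w measure"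
  where "natural_filtration P S X s =
    sigma (space P) (\<Union>u\<in>{0..s}. {X u -` A \<inter> space P |A. A \<in> sets S})"

(* The law of X 0 is arbitrary; by distr_markov_process below, the law of X t is
   the law of X 0 acted upon by p t. *)
definition markov_process ::
    "'w measure \<Rightarrow> 'x measure \<Rightarrow> (real \<Rightarrow> 'w \<Rightarrow> 'x) \<Rightarrow> (real \<Rightarrow> 'x \<Rightarrow> 'x measure) \<Rightarrow> bool"
  where "markov_process P S X p \<longleftrightarrow>
    prob_space P \<and>
    (\<forall>t\<ge>0. X t \<in> P \<rightarrow>\<^sub>M S) \<and>
    markov_transition_function S p \<and>
    (\<forall>s\<ge>0. \<forall>t\<ge>0. \<forall>A\<in>sets S. AE \<omega> in P.
      real_cond_exp P (natural_filtration P S X s) (\<lambda>\<omega>'. indicator A (X (s + t) \<omega>')) \<omega>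
        = measure (p t (X s \<omega>)) A)"

lemma subalgebra_natural_filtration:
  assumes "\<And>t. t \<ge> 0 \<Longrightarrow> X t \<in> P \<rightarrow>\<^sub>M S"
  shows "subalgebra P (natural_filtration P S X s)"
proof -
  let ?G = "\<Union>u\<in>{0..s}. {X u -` A \<inter> space P |A. A \<in> sets S}"
  have "?G \<subseteq> sets P"
    using assms by (auto intro: measurable_sets)
  moreover have "?G \<subseteq> Pow (space P)" by auto
  ultimately show ?thesis
    unfolding subalgebra_def natural_filtration_def
    by (simp add: sets.sigma_sets_subset space_measure_of_conv sets_measure_of)
qed

lemma distr_markov_process:
  assumes "markov_process P S X p" and "t \<ge> 0"
  shows "distr P S (X t) = distr P S (X 0) \<bind> p t"
proof -
  interpret prob_space P using assms by (simp add: markov_process_def)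
  have X: "\<And>t. t \<ge> 0 \<Longrightarrow> X t \<in> P \<rightarrow>\<^sub>M S"
    and p: "p t \<in> S \<rightarrow>\<^sub>M prob_algebra S"
    using assms by (auto simp: markov_process_def markov_transition_function_def)
  let ?F = "natural_filtration P S X 0"
  have sub: "subalgebra P ?F" by (rule subalgebra_natural_filtration[OF X])
  interpret F: finite_measure_subalgebra P ?F
    by standard (rule sub)
  have X0[measurable]: "X 0 \<in> P \<rightarrow>\<^sub>M S" and Xt[measurable]: "X t \<in> P \<rightarrow>\<^sub>M S"
    using X assms by auto
  note p[measurable]
  have p': "p t \<in> S \<rightarrow>\<^sub>M subprob_algebra S"
    using p by (rule measurable_prob_algebraD)
  note p'[measurable]
  have D0: "distr P S (X 0) \<in> space (prob_algebra S)"
    by (simp add: space_prob_algebra prob_space_distr)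
  show ?thesis
  proof (rule measure_eqI)
    show "sets (distr P S (X t)) = sets (distr P S (X 0) \<bind> p t)"
      using D0 p by (simp add: sets_bind'[OF D0 p])
  next
    fix A assume "A \<in> sets (distr P S (X t))"
    then have A[measurable]: "A \<in> sets S" by simp
    have int: "integrable P (\<lambda>\<omega>. indicator A (X t \<omega>) :: real)"
      by (intro integrable_const_bound[where B=1]) (auto split: split_indicator)
    have ae: "AE \<omega> in P. real_cond_exp P ?F (\<lambda>\<omega>'. indicator A (X t \<omega>')) \<omega>
        = measure (p t (X 0 \<omega>)) A"
    proof -
      have "\<forall>s\<ge>0. \<forall>t\<ge>0. \<forall>A\<in>sets S. AE \<omega> in P.
          real_cond_exp P (natural_filtration P S X s) (\<lambda>\<omega>'. indicator A (X (s + t) \<omega>')) \<omega>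
            = measure (p t (X s \<omega>)) A"
        using assms(1) unfolding markov_process_def by blast
      from this[rule_format, of 0 t A] show ?thesis
        using assms(2) A by simp
    qed
    have meas: "(\<lambda>\<omega>. measure (p t (X 0 \<omega>)) A) \<in> borel_measurable P"
      by measurable
    have ps: "prob_space (p t (X 0 \<omega>))" if "\<omega> \<in> space P" for \<omega>
      using measurable_space[OF p measurable_space[OF X0 that]] by (simp add: space_prob_algebra)
    have "emeasure (distr P S (X t)) A = ennreal (measure P (X t -` A \<inter> space P))"
      by (simp add: emeasure_distr emeasure_eq_measure)
    also have "measure P (X t -` A \<inter> space P) = (\<integral>\<omega>. indicator A (X t \<omega>) \<partial>P)"
    proof -
      have "measure P (X t -` A \<inter> space P) = (\<integral>\<omega>. indicator (X t -` A \<inter> space P) \<omega> \<partial>P)"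
        by simp
      also have "\<dots> = (\<integral>\<omega>. indicator A (X t \<omega>) \<partial>P)"
        by (intro Bochner_Integration.integral_cong) (auto split: split_indicator)
      finally show ?thesis .
    qed
    also have "\<dots> = (\<integral>\<omega>. real_cond_exp P ?F (\<lambda>\<omega>'. indicator A (X t \<omega>')) \<omega> \<partial>P)"
      by (rule F.real_cond_exp_int(2)[OF int, symmetric])
    also have "\<dots> = (\<integral>\<omega>. measure (p t (X 0 \<omega>)) A \<partial>P)"
      by (rule integral_cong_AE) (use ae meas in auto)
    also have "ennreal \<dots> = (\<integral>\<^sup>+\<omega>. ennreal (measure (p t (X 0 \<omega>)) A) \<partial>P)"
      by (rule nn_integral_eq_integral[symmetric])
        (auto intro!: integrable_const_bound[where B=1] meas prob_space.prob_le_1 ps)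
    also have "\<dots> = (\<integral>\<^sup>+\<omega>. emeasure (p t (X 0 \<omega>)) A \<partial>P)"
      by (intro nn_integral_cong finite_measure.emeasure_eq_measure[symmetric]
          prob_space.finite_measure ps)
    also have "\<dots> = (\<integral>\<^sup>+x. emeasure (p t x) A \<partial>distr P S (X 0))"
      by (rule nn_integral_distr[symmetric]) auto
    also have "\<dots> = emeasure (distr P S (X 0) \<bind> p t) A"
      by (rule emeasure_bind_prob_algebra[OF D0 p A, symmetric])
    finally show "emeasure (distr P S (X t)) A = emeasure (distr P S (X 0) \<bind> p t) A" .
  qed
qed

end

theory Submission
  imports Defs
begin

text \<open>
  Writing a time beyond \<open>\<tau>\<close> as \<open>s + \<tau>\<close>, compare both laws with the one obtained by running the
  approximation up to time \<open>s\<close> and the exact dynamics from then on. Contractivity shrinks the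
  error at time \<open>s\<close> by the factor \<open>q = exp (- \<kappa> * \<tau>) < 1\<close>, and the last stretch adds at most
  \<open>b = \<delta> powr \<alpha> * C \<nu>\<close>. The bound \<open>b / (1 - q)\<close> is a fixed point of \<open>e \<mapsto> q * e + b\<close>.
\<close>

text \<open>Repeatedly subtracting \<open>\<tau>\<close> carries any time into the first window,
  where \<open>initial\<close> applies. Going back up, each \<open>step\<close> preserves the bound
  because it is a fixed point and multiplication by \<open>q\<close> is monotone.\<close>

lemma affine_recursion_bound:
  fixes f :: "real \<Rightarrow> real"
  assumes "\<tau> > 0" and q: "0 \<le> q" "q < 1" and "0 \<le> b"
    and initial: "\<And>t. 0 \<le> t \<Longrightarrow> t \<le> \<tau> \<Longrightarrow> f t \<le> b"
    and step: "\<And>s. 0 \<le> s \<Longrightarrow> f (s + \<tau>) \<le> q * f s + b"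
    and "0 \<le> t"
  shows "f t \<le> b / (1 - q)"
proof -
  \<comment> \<open>With \<open>Suc n\<close> the base case is the whole first window rather than
    time 0 alone.\<close>
  have bound: "f t \<le> b / (1 - q)" if "0 \<le> t" "t \<le> real (Suc n) * \<tau>" for n t
    using that
  proof (induction n arbitrary: t)
    case 0
    then have "f t \<le> b" using initial by simp
    also have "b \<le> b / (1 - q)"
      using q \<open>0 \<le> b\<close> by (simp add: field_simps)
    finally show ?case .
  next
    case (Suc n)
    show ?case
    proof (cases "t \<le> \<tau>")
      \<comment> \<open>Here \<open>t - \<tau>\<close> may be negative, out of reach of
        \<open>step\<close>; but \<open>t\<close> itself already lies in the range of the induction
        hypothesis.\<close>
      case True
      then have "t \<le> real (Suc n) * \<tau>"
        using \<open>\<tau> > 0\<close> by (simp add: algebra_simps add_increasing2)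
      then show ?thesis using Suc by simp
    next
      case False
      have "f (t - \<tau>) \<le> b / (1 - q)"
        using False Suc.prems by (intro Suc.IH) (auto simp: algebra_simps)
      then have "q * f (t - \<tau>) \<le> q * (b / (1 - q))"
        using q by (intro mult_left_mono)
      moreover have "q * (b / (1 - q)) + b = b / (1 - q)"
        using q by (simp add: field_simps)
      ultimately show ?thesis
        using step[of "t - \<tau>"] False by simp
    qed
  qed
  obtain n where "t / \<tau> \<le> real n"
    using real_arch_simple by blast
  then have "t \<le> real (Suc n) * \<tau>"
    using \<open>\<tau> > 0\<close> by (simp add: field_simps)
  with bound \<open>0 \<le> t\<close> show ?thesis by blast
qed

lemma bind_in_prob_measures:
  assumes "\<mu> \<in> prob_measures S" and "K \<in> S \<rightarrow>\<^sub>M prob_algebra S"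
  shows "\<mu> \<bind> K \<in> prob_measures S"
  using assms by (auto simp: space_prob_algebra sets_bind' intro!: prob_space_bind')

theorem theorem1p1:
  fixes S :: "'x measure"
    and P :: "'w measure" and X :: "real \<Rightarrow> 'w \<Rightarrow> 'x"
    and p :: "real \<Rightarrow> 'x \<Rightarrow> 'x measure"
    and P\<delta> :: "real \<Rightarrow> 'v measure" and X\<delta> :: "real \<Rightarrow> real \<Rightarrow> 'v \<Rightarrow> 'x"
    and p\<delta> :: "real \<Rightarrow> real \<Rightarrow> 'x \<Rightarrow> 'x measure"
    and d :: "'x measure \<Rightarrow> 'x measure \<Rightarrow> real"
    and \<tau> \<alpha> :: real and MM :: "'x measure \<Rightarrow> real"
    and \<nu> :: "'x measure"
  assumes process: "markov_process P S X p"
    and process_\<delta>: "\<And>\<delta>. \<delta> > 0 \<Longrightarrow> markov_process (P\<delta> \<delta>) S (X\<delta> \<delta>) (p\<delta> \<delta>)"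
    and distance: "Metric_space (prob_measures S) d"
    and contractivity:
      "\<exists>\<kappa>>0. \<forall>\<mu>\<in>prob_measures S. \<forall>\<eta>\<in>prob_measures S. \<forall>t>0.
         d (\<mu> \<bind> p t) (\<eta> \<bind> p t) \<le> exp (- \<kappa> * t) * d \<mu> \<eta>"
    and \<tau>_pos: "\<tau> > 0" and \<alpha>_pos: "\<alpha> > 0"
    and MM_nonneg: "\<And>\<mu>. \<mu> \<in> prob_measures S \<Longrightarrow> MM \<mu> \<ge> 0"
    and finite_time_convergence:
      "\<And>\<mu> \<delta>. \<mu> \<in> prob_measures S \<Longrightarrow> \<delta> > 0 \<Longrightarrow>
         (SUP t\<in>{0..\<tau>}. ereal (d (\<mu> \<bind> p t) (\<mu> \<bind> p\<delta> \<delta> t))) \<le> ereal (\<delta> powr \<alpha> * MM \<mu>)"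
    and uniform_control:
      "\<And>\<mu>. \<mu> \<in> prob_measures S \<Longrightarrow>
         \<exists>C::real. \<forall>\<delta>>0. (SUP t\<in>{0..}. ereal (MM (\<mu> \<bind> p\<delta> \<delta> t))) \<le> ereal C"
    and \<nu>: "\<nu> \<in> prob_measures S"
  shows "\<exists>C>0. \<forall>t\<ge>0. \<forall>\<delta>>0. d (\<nu> \<bind> p t) (\<nu> \<bind> p\<delta> \<delta> t) \<le> C * \<delta> powr \<alpha>"
proof -
  interpret Metric_space "prob_measures S" d by (rule distance)
  have p: "markov_transition_function S p"
    using process by (simp add: markov_process_def)
  have p\<delta>: "markov_transition_function S (p\<delta> \<delta>)" if "\<delta> > 0" for \<delta>
    using process_\<delta>[OF that] by (simp add: markov_process_def)
  have in_prob: "\<mu> \<bind> k t \<in> prob_measures S"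
    if "markov_transition_function S k" "\<mu> \<in> prob_measures S" "t \<ge> 0" for k \<mu> t
    using that by (auto simp: markov_transition_function_def intro: bind_in_prob_measures)
  obtain \<kappa> where "\<kappa> > 0" and contr: "\<And>\<mu> \<eta> t. \<mu> \<in> prob_measures S \<Longrightarrow> \<eta> \<in> prob_measures S \<Longrightarrow> t > 0
      \<Longrightarrow> d (\<mu> \<bind> p t) (\<eta> \<bind> p t) \<le> exp (- \<kappa> * t) * d \<mu> \<eta>"
    using contractivity by blast
  \<comment> \<open>This constant is chosen before any \<open>\<delta>\<close> or \<open>t\<close>
    is fixed, which makes the final constant independent of both.\<close>
  obtain C where C: "\<And>\<delta> t. \<delta> > 0 \<Longrightarrow> t \<ge> 0 \<Longrightarrow> MM (\<nu> \<bind> p\<delta> \<delta> t) \<le> C"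
    using uniform_control[OF \<nu>] by (auto simp: SUP_le_iff)
  define q where "q = exp (- \<kappa> * \<tau>)"
  have q: "0 \<le> q" "q < 1"
    using \<open>\<kappa> > 0\<close> \<tau>_pos by (auto simp: q_def)
  \<comment> \<open>The sign of \<open>C\<close> is not given; it follows by evaluating at one
    admissible pair, here \<open>\<delta> = 1\<close> and time 0.\<close>
  have "MM (\<nu> \<bind> p\<delta> 1 0) \<ge> 0"
    using MM_nonneg in_prob[OF p\<delta> \<nu>] by simp
  then have "C \<ge> 0" using C[of 1 0] by simp
  have local: "d (\<mu> \<bind> p t) (\<mu> \<bind> p\<delta> \<delta> t) \<le> \<delta> powr \<alpha> * MM \<mu>"
    if "\<mu> \<in> prob_measures S" "\<delta> > 0" "0 \<le> t" "t \<le> \<tau>" for \<mu> \<delta> t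
    using finite_time_convergence[OF that(1,2)] that(3,4) by (simp add: SUP_le_iff)
  \<comment> \<open>The one-window error is restarted from the approximate law at time
    \<open>s\<close>. Uniform control keeps \<open>MM\<close> of that moving starting law below
    \<open>C\<close>, so errors in late windows are no worse than in the first.\<close>
  have local_C: "d ((\<nu> \<bind> p\<delta> \<delta> s) \<bind> p t) ((\<nu> \<bind> p\<delta> \<delta> s) \<bind> p\<delta> \<delta> t) \<le> C * \<delta> powr \<alpha>"
    if "\<delta> > 0" "0 \<le> s" "0 \<le> t" "t \<le> \<tau>" for \<delta> s t
  proof -
    have "d ((\<nu> \<bind> p\<delta> \<delta> s) \<bind> p t) ((\<nu> \<bind> p\<delta> \<delta> s) \<bind> p\<delta> \<delta> t)
        \<le> \<delta> powr \<alpha> * MM (\<nu> \<bind> p\<delta> \<delta> s)"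
      using that by (intro local in_prob[OF p\<delta> \<nu>])
    also have "\<dots> \<le> \<delta> powr \<alpha> * C"
      using C that by (intro mult_left_mono) auto
    finally show ?thesis by (simp only: mult.commute)
  qed
  have main: "d (\<nu> \<bind> p t) (\<nu> \<bind> p\<delta> \<delta> t) \<le> C * \<delta> powr \<alpha> / (1 - q)"
    if "\<delta> > 0" "t \<ge> 0" for \<delta> t
  proof (rule affine_recursion_bound[where f = "\<lambda>t. d (\<nu> \<bind> p t) (\<nu> \<bind> p\<delta> \<delta> t)",
        OF \<tau>_pos q])
    show "0 \<le> C * \<delta> powr \<alpha>" using \<open>C \<ge> 0\<close> by simp
    show "0 \<le> t" by fact
    \<comment> \<open>Makes the first window the instance \<open>s = 0\<close> of
      \<open>local_C\<close>.\<close>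
    have "\<nu> \<bind> p\<delta> \<delta> 0 = \<nu>"
      using p\<delta>[OF \<open>\<delta> > 0\<close>] \<nu> by (simp add: markov_transition_function_def)
    then show "d (\<nu> \<bind> p t) (\<nu> \<bind> p\<delta> \<delta> t) \<le> C * \<delta> powr \<alpha>" if "0 \<le> t" "t \<le> \<tau>" for t
      using local_C[of \<delta> 0 t] \<open>\<delta> > 0\<close> that by simp
  next
    fix s :: real assume s: "0 \<le> s"
    let ?\<mu> = "\<nu> \<bind> p s" and ?\<eta> = "\<nu> \<bind> p\<delta> \<delta> s"
    have \<mu>: "?\<mu> \<in> prob_measures S" and \<eta>: "?\<eta> \<in> prob_measures S"
      using in_prob[OF p \<nu> s] in_prob[OF p\<delta>[OF \<open>\<delta> > 0\<close>] \<nu> s] .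
    have split: "\<nu> \<bind> p (s + \<tau>) = ?\<mu> \<bind> p \<tau>" "\<nu> \<bind> p\<delta> \<delta> (s + \<tau>) = ?\<eta> \<bind> p\<delta> \<delta> \<tau>"
      using p p\<delta>[OF \<open>\<delta> > 0\<close>] \<nu> s \<tau>_pos by (auto simp: markov_transition_function_def)
    \<comment> \<open>The intermediate law shares its kernel with the first law, so contractivity
      applies, and its starting law with the second, so \<open>local_C\<close> applies.\<close>
    have "d (?\<mu> \<bind> p \<tau>) (?\<eta> \<bind> p\<delta> \<delta> \<tau>)
        \<le> d (?\<mu> \<bind> p \<tau>) (?\<eta> \<bind> p \<tau>) + d (?\<eta> \<bind> p \<tau>) (?\<eta> \<bind> p\<delta> \<delta> \<tau>)"
      using \<tau>_pos by (intro triangle in_prob p p\<delta> \<mu> \<eta> \<open>\<delta> > 0\<close>) auto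
    also have "\<dots> \<le> q * d ?\<mu> ?\<eta> + C * \<delta> powr \<alpha>"
      using contr[OF \<mu> \<eta> \<tau>_pos] local_C[OF \<open>\<delta> > 0\<close> s] \<tau>_pos
      by (intro add_mono) (auto simp: q_def)
    finally show "d (\<nu> \<bind> p (s + \<tau>)) (\<nu> \<bind> p\<delta> \<delta> (s + \<tau>)) \<le> q * d ?\<mu> ?\<eta> + C * \<delta> powr \<alpha>"
      by (simp only: split)
  qed
  show ?thesis
  proof (intro exI conjI allI impI)
    \<comment> \<open>\<open>C\<close> may be 0, so 1 is added to make the constant strictly
      positive.\<close>
    show "C / (1 - q) + 1 > 0"
      using q \<open>C \<ge> 0\<close> by (intro add_nonneg_pos) auto
    fix t \<delta> :: real assume "t \<ge> 0" "\<delta> > 0"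
    then have "d (\<nu> \<bind> p t) (\<nu> \<bind> p\<delta> \<delta> t) \<le> C / (1 - q) * \<delta> powr \<alpha>"
      using main by simp
    also have "\<dots> \<le> (C / (1 - q) + 1) * \<delta> powr \<alpha>"
      by (intro mult_right_mono) auto
    finally show "d (\<nu> \<bind> p t) (\<nu> \<bind> p\<delta> \<delta> t) \<le> (C / (1 - q) + 1) * \<delta> powr \<alpha>" .
  qed
qed

end
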